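(* Let $N=\{1,\dots,n\}$ be a set of firms with budgets $K_i$ ($i\in N$), $M=\{1,\dots,m\}$ a set of goods, and $v_{ij}$ ($i\in N$, $j\in M$) the firms' valuations of the goods. Suppose that $\mathbf b^\#$ is a market equilibrium spending vector of the quasi-linear Fisher market with these data, and $\mathbf p^\#$ is the corresponding market equilibrium price vector. For every $i\in N$ let $\beta_i:=\max_{j\in M}\{v_{ij}/p^\#_j\}$. Let $0<\delta<1$. If $\max_{i\in N,j\in M}\{K_i/p^\#_j\}\le\delta$, then $\mathbf b^\#$ is also a $\delta'$-Nash equilibrium of the corresponding Tullock contest (with the same $K_i$ and $v_{ij}$), where $$\delta'=\max_{i:\ \beta_i>1}\left\{\frac{\frac{\beta_i}{1-\delta}-1}{\beta_i-1}\right\}-1,$$ provided that there is no firm $k$ with $1-\delta<\beta_k<1$.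
   Context: In both models firm $i$ chooses $\mathbf b_i=(b_{ij})_{j\in M}$ with $b_{ij}\ge0$ and $\sum_j b_{ij}\le K_i$. Quasi-linear Fisher market: there is one unit of each good. At a price vector $\mathbf p=(p_j)_{j\in M}$ with positive entries the utility of firm $i$ is $u_i(\mathbf b_i\mid\mathbf p)=\sum_j v_{ij}b_{ij}/p_j-\sum_j b_{ij}$. An optimal budget allocation of firm $i$ at $\mathbf p$ is a feasible maximizer of $u_i(\cdot\mid\mathbf p)$. A price vector $\mathbf p^\#$ is a market equilibrium if there are optimal budget allocations $\mathbf b^\#_i$ ($i\in N$) at $\mathbf p^\#$ with $\sum_i b^\#_{ij}=p^\#_j$ for every good $j$; $\mathbf b^\#=(\mathbf b_i^\#)_{i\in N}$ is then called a market equilibrium spending vector and $\mathbf p^\#$ the corresponding market equilibrium price vector. Tullock contest: the utility of firm $i$ at a profile $\mathbf b=(\mathbf b_i)_{i\in N}$ is $u_i(\mathbf b_i,\mathbf b_{-i})=\sum_j v_{ij}y_{ij}-\sum_j b_{ij}$ with $y_{ij}=b_{ij}/\sum_k b_{kj}$, where $\mathbf b_{-i}$ denotes the choices of the firms other than $i$. For $\varepsilon\ge0$, a profile $\mathbf b^*$ is an $\varepsilon$-Nash equilibrium if for every $i\in N$, $\max_{\mathbf b_i\ge 0:\ \sum_j b_{ij}\le K_i}u_i(\mathbf b_i,\mathbf b^*_{-i})\le(1+\varepsilon)\,u_i(\mathbf b^*_i,\mathbf b^*_{-i})$.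
   Formalization: The formal theorem additionally assumes that every firm k with β_k = 1 spends nothing in b#; without this the claim is false, since such a firm has zero contest utility and gains by lowering its bids. *)

theory Defs
  imports Complex_Main
begin

text \<open>
  The firms are the elements of a finite type \<open>'n\<close> and the goods those of a finite type \<open>'m\<close>;
  \<open>K i\<close> is the budget of firm \<open>i\<close>, \<open>v i j\<close> its valuation of good \<open>j\<close>, and \<open>b i j\<close> the
  amount it spends on good \<open>j\<close>.
\<close>

definition budget_set :: "real \<Rightarrow> ('m::finite \<Rightarrow> real) set" where
  "budget_set k = {x. (\<forall>j. 0 \<le> x j) \<and> (\<Sum>j\<in>UNIV. x j) \<le> k}"

definition fisher_utility :: "('m::finite \<Rightarrow> real) \<Rightarrow> ('m \<Rightarrow> real) \<Rightarrow> ('m \<Rightarrow> real) \<Rightarrow> real" where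
  "fisher_utility w p x = (\<Sum>j\<in>UNIV. w j * x j / p j) - (\<Sum>j\<in>UNIV. x j)"

definition optimal_allocation ::
  "real \<Rightarrow> ('m::finite \<Rightarrow> real) \<Rightarrow> ('m \<Rightarrow> real) \<Rightarrow> ('m \<Rightarrow> real) \<Rightarrow> bool" where
  "optimal_allocation k w p x \<longleftrightarrow> is_arg_max (fisher_utility w p) (\<lambda>y. y \<in> budget_set k) x"

definition market_equilibrium ::
  "('n::finite \<Rightarrow> real) \<Rightarrow> ('n \<Rightarrow> 'm::finite \<Rightarrow> real) \<Rightarrow> ('n \<Rightarrow> 'm \<Rightarrow> real) \<Rightarrow> ('m \<Rightarrow> real) \<Rightarrow> bool" where
  "market_equilibrium K v b p \<longleftrightarrow>
     (\<forall>j. 0 < p j) \<and>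
     (\<forall>i. optimal_allocation (K i) (v i) p (b i)) \<and>
     (\<forall>j. (\<Sum>i\<in>UNIV. b i j) = p j)"

text \<open>
  A good on which nobody bids is awarded to nobody: the quotient below is then \<open>0 / 0 = 0\<close>.
\<close>

definition tullock_utility ::
  "('n::finite \<Rightarrow> 'm::finite \<Rightarrow> real) \<Rightarrow> 'n \<Rightarrow> ('n \<Rightarrow> 'm \<Rightarrow> real) \<Rightarrow> real" where
  "tullock_utility v i b =
     (\<Sum>j\<in>UNIV. v i j * (b i j / (\<Sum>k\<in>UNIV. b k j))) - (\<Sum>j\<in>UNIV. b i j)"

text \<open>
  The profile \<open>b(i := x)\<close> is \<open>b\<close> with the choice of firm \<open>i\<close> replaced by \<open>x\<close>. That the maximal
  utility over all such deviations is at most a bound is written as: every deviation satisfies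
  the bound.
\<close>

definition eps_nash_equilibrium ::
  "real \<Rightarrow> ('n::finite \<Rightarrow> real) \<Rightarrow> ('n \<Rightarrow> 'm::finite \<Rightarrow> real) \<Rightarrow> ('n \<Rightarrow> 'm \<Rightarrow> real) \<Rightarrow> bool" where
  "eps_nash_equilibrium \<epsilon> K v b \<longleftrightarrow>
     0 \<le> \<epsilon> \<and>
     (\<forall>i. b i \<in> budget_set (K i)) \<and>
     (\<forall>i. \<forall>x\<in>budget_set (K i).
        tullock_utility v i (b(i := x)) \<le> (1 + \<epsilon>) * tullock_utility v i b)"

end

theory Submission
  imports Defs
begin

text \<open>
  By changing its own bid, firm \<open>i\<close> can move the total bid on good \<open>j\<close> from \<open>p j\<close> down to
  \<open>p j - K i \<ge> (1 - \<delta>) * p j\<close> at most. Hence every unit of money spent in a deviation wins a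
  value of at most \<open>\<beta> i / (1 - \<delta>)\<close>, against \<open>\<beta> i\<close> at the equilibrium, where a firm with
  \<open>\<beta> i > 1\<close> spends its whole budget. A firm with \<open>\<beta> i \<le> 1\<close> bids nothing, so its deviations only
  raise the totals and cannot make a profit. Such firms cannot be the only ones, since prices are
  positive, so the maximum defining the approximation factor ranges over a nonempty set.
\<close>

lemma fisher_utility_eq:
  "fisher_utility w p x = (\<Sum>j\<in>UNIV. (w j / p j - 1) * x j)"
  by (simp add: fisher_utility_def sum_subtractf[symmetric] algebra_simps)

lemma optimal_allocationD:
  assumes "optimal_allocation k w p x"
  shows "x \<in> budget_set k"
    and "y \<in> budget_set k \<Longrightarrow> fisher_utility w p y \<le> fisher_utility w p x"
  using assms by (auto simp: optimal_allocation_def is_arg_max_def not_less)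

lemma budget_set_le:
  assumes "x \<in> budget_set k"
  shows "x j \<le> k"
proof -
  have "x j \<le> (\<Sum>j\<in>UNIV. x j)"
    using assms by (intro member_le_sum) (auto simp: budget_set_def)
  then show ?thesis using assms by (simp add: budget_set_def)
qed

lemma budget_set_nonneg: "x \<in> budget_set k \<Longrightarrow> 0 \<le> k"
  using budget_set_le[of x k] by (fastforce simp: budget_set_def intro: order_trans)

text \<open>Spending nothing is feasible with utility 0, while here every unit spent makes a loss.
  The total loss is therefore a sum of nonnegative terms that is at most 0, so each term
  vanishes.\<close>

lemma optimal_allocation_eq_0:
  assumes opt: "optimal_allocation k w p x" and less: "\<And>j. w j / p j < 1"
  shows "x j = 0"
proof -
  have x: "x \<in> budget_set k" and "(\<lambda>_. 0) \<in> budget_set k"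
    using optimal_allocationD(1)[OF opt] budget_set_nonneg by (auto simp: budget_set_def)
  then have "0 \<le> (\<Sum>j\<in>UNIV. (w j / p j - 1) * x j)"
    using optimal_allocationD(2)[OF opt, of "\<lambda>_. 0"] by (simp add: fisher_utility_eq)
  moreover have nonneg: "0 \<le> (1 - w j / p j) * x j" for j
    using x less[of j] by (simp add: budget_set_def)
  ultimately have "(\<Sum>j\<in>UNIV. (1 - w j / p j) * x j) = 0"
    by (intro antisym sum_nonneg) (simp_all add: algebra_simps sum_subtractf)
  then have "(1 - w j / p j) * x j = 0"
    using nonneg by (simp add: sum_nonneg_eq_0_iff)
  then show ?thesis using less[of j] unfolding mult_eq_0_iff by linarith
qed

text \<open>Comparison with spending the whole budget on good \<open>j\<close>; a good with the best
  ratio gives the benchmark against which deviations are measured.\<close>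

lemma optimal_allocation_utility_ge:
  fixes w :: "'m::finite \<Rightarrow> real"
  assumes opt: "optimal_allocation k w p x"
  shows "(w j / p j - 1) * k \<le> fisher_utility w p x"
proof -
  let ?y = "\<lambda>l. if l = j then k else 0"
  have "?y \<in> budget_set k"
    using budget_set_nonneg[OF optimal_allocationD(1)[OF opt]] by (simp add: budget_set_def)
  then have "fisher_utility w p ?y \<le> fisher_utility w p x"
    by (rule optimal_allocationD(2)[OF opt])
  then show ?thesis by (simp add: fisher_utility_eq if_distrib cong: if_cong)
qed

text \<open>Once markets clear, the price is the total bid, so the share won in the contest is the
  amount bought in the market.\<close>

lemma tullock_utility_eq_fisher_utility:
  assumes "\<And>j. (\<Sum>i\<in>UNIV. b i j) = p j"
  shows "tullock_utility v i b = fisher_utility (v i) p (b i)"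
  using assms by (simp add: tullock_utility_def fisher_utility_def)

lemma sum_fun_upd_profile:
  fixes b :: "'n::finite \<Rightarrow> 'm \<Rightarrow> real"
  shows "(\<Sum>k\<in>UNIV. (b(i := x)) k j) = (\<Sum>k\<in>UNIV. b k j) - b i j + x j"
  by (simp add: sum.remove[of UNIV i])

text \<open>The bids of the others alone reach \<open>q j\<close> and the deviator's own bid only
  adds to them, so a unit of money wins value at most \<open>c\<close>. Active and inactive firms
  use different \<open>q\<close> and \<open>c\<close>.\<close>

lemma tullock_utility_deviation_le:
  fixes b :: "'n::finite \<Rightarrow> 'm::finite \<Rightarrow> real"
  assumes x: "x \<in> budget_set k"
    and q: "\<And>j. 0 < q j" "\<And>j. q j \<le> (\<Sum>k\<in>UNIV. b k j) - b i j"
    and c: "0 \<le> c" "\<And>j. v i j \<le> c * q j"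
  shows "tullock_utility v i (b(i := x)) \<le> (c - 1) * (\<Sum>j\<in>UNIV. x j)"
proof -
  have "v i j * (x j / (\<Sum>k\<in>UNIV. (b(i := x)) k j)) \<le> c * x j" for j
  proof -
    let ?t = "\<Sum>k\<in>UNIV. (b(i := x)) k j"
    have xj: "0 \<le> x j" using x by (simp add: budget_set_def)
    have t: "q j \<le> ?t" using q(2)[of j] xj by (simp only: sum_fun_upd_profile)
    then have t0: "0 < ?t" using q(1)[of j] by linarith
    have "v i j \<le> c * ?t"
      using c(2)[of j] mult_left_mono[OF t c(1)] by linarith
    then have "v i j * x j \<le> c * ?t * x j" using xj by (rule mult_right_mono)
    then show ?thesis using t0 by (simp add: pos_divide_le_eq mult_ac del: fun_upd_apply)
  qed
  then have "(\<Sum>j\<in>UNIV. v i j * (x j / (\<Sum>k\<in>UNIV. (b(i := x)) k j))) \<le> (\<Sum>j\<in>UNIV. c * x j)"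
    by (intro sum_mono)
  then show ?thesis
    by (simp add: tullock_utility_def sum_distrib_left[symmetric] algebra_simps)
qed

theorem proposition3:
  fixes K :: "'n::finite \<Rightarrow> real"
    and v :: "'n \<Rightarrow> 'm::finite \<Rightarrow> real"
    and b :: "'n \<Rightarrow> 'm \<Rightarrow> real"
    and p :: "'m \<Rightarrow> real"
    and \<beta> :: "'n \<Rightarrow> real"
    and \<delta> :: real
  assumes equilibrium: "market_equilibrium K v b p"
    and beta: "\<And>i. \<beta> i = Max {v i j / p j | j. True}"
    and delta: "0 < \<delta>" "\<delta> < 1"
    and small: "Max {K i / p j | i j. True} \<le> \<delta>"
    and no_gap: "\<not> (\<exists>k. 1 - \<delta> < \<beta> k \<and> \<beta> k < 1)"
    and indifferent: "\<And>k j. \<beta> k = 1 \<Longrightarrow> b k j = 0"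
  shows "eps_nash_equilibrium
           (Max {(\<beta> i / (1 - \<delta>) - 1) / (\<beta> i - 1) | i. \<beta> i > 1} - 1) K v b"
proof -
  let ?r = "\<lambda>i. (\<beta> i / (1 - \<delta>) - 1) / (\<beta> i - 1)"
  let ?R = "{?r i | i. \<beta> i > 1}"
  let ?\<epsilon> = "Max ?R - 1"
  have p: "0 < p j" and opt: "optimal_allocation (K i) (v i) p (b i)"
    and clear: "(\<Sum>i\<in>UNIV. b i j) = p j" for i j
    using equilibrium by (auto simp: market_equilibrium_def)
  have b: "b i \<in> budget_set (K i)" for i
    by (rule optimal_allocationD(1)[OF opt])
  have K: "0 \<le> K i" for i
    by (rule budget_set_nonneg[OF b])
  have v_le: "v i j / p j \<le> \<beta> i" for i j
    unfolding beta by (rule Max_ge) (auto simp: full_SetCompr_eq)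
  have best: "\<exists>j. v i j / p j = \<beta> i" for i
  proof -
    have "\<beta> i \<in> {v i j / p j | j. True}"
      unfolding beta by (rule Max_in) (auto simp: full_SetCompr_eq)
    then show ?thesis by auto
  qed
  have "K i / p j \<le> Max {K i / p j | i j. True}" for i j
    by (rule Max_ge) (auto intro!: finite_image_set2[where P = "\<lambda>_. True" and Q = "\<lambda>_. True", simplified])
  then have "K i / p j \<le> \<delta>" for i j
    using small order_trans by blast
  then have K_le: "K i \<le> \<delta> * p j" for i j
    using p[of j] pos_divide_le_eq by blast
  \<comment> \<open>At \<open>\<beta> i = 1\<close> optimality does not determine the spending,
    since the best goods yield exactly zero profit; that case rests on
    \<open>indifferent\<close>.\<close>
  have inactive: "b i j = 0" if "\<beta> i \<le> 1" for i j
  proof (cases "\<beta> i = 1")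
    case True
    then show ?thesis by (rule indifferent)
  next
    case False
    then have "v i j / p j < 1" for j using v_le[of i j] that by linarith
    then show ?thesis by (rule optimal_allocation_eq_0[OF opt])
  qed
  have ratio_le: "?r i \<le> 1 + ?\<epsilon>" if "\<beta> i > 1" for i
    using that by (auto intro!: Max_ge)
  obtain k where k: "\<beta> k > 1"
  proof (rule ccontr)
    assume "\<not> thesis"
    then have "b i j = 0" for i j using inactive that by (meson not_less)
    then show False using clear p by (metis less_irrefl sum.neutral)
  qed
  \<comment> \<open>Division by \<open>1 - \<delta>\<close> only raises \<open>\<beta> k\<close>, so
    the maximum is at least 1. This gives \<open>0 \<le> ?\<epsilon>\<close>, part of the
    equilibrium notion.\<close>
  have "\<beta> k * (1 - \<delta>) \<le> \<beta> k" using k delta by simp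
  then have "\<beta> k \<le> \<beta> k / (1 - \<delta>)" using delta by (simp add: pos_le_divide_eq)
  then have "1 \<le> ?r k" using k by simp
  then have eps: "0 \<le> ?\<epsilon>" using ratio_le[OF k] by linarith
  have "tullock_utility v i (b(i := x)) \<le> (1 + ?\<epsilon>) * tullock_utility v i b"
    if x: "x \<in> budget_set (K i)" for i x
  proof (cases "\<beta> i > 1")
    case True
    let ?c = "\<beta> i / (1 - \<delta>)"
    have c: "1 \<le> ?c" using True delta by (simp add: pos_le_divide_eq)
    have "tullock_utility v i (b(i := x)) \<le> (?c - 1) * (\<Sum>j\<in>UNIV. x j)"
    proof (rule tullock_utility_deviation_le[where q = "\<lambda>j. (1 - \<delta>) * p j", OF x])
      show "0 < (1 - \<delta>) * p j" for j using p delta by simp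
      show "(1 - \<delta>) * p j \<le> (\<Sum>k\<in>UNIV. b k j) - b i j" for j
        using budget_set_le[OF b, of i j] K_le[of i j] by (simp add: clear algebra_simps)
      show "0 \<le> ?c" using c by linarith
      show "v i j \<le> ?c * ((1 - \<delta>) * p j)" for j
        using v_le[of i j] p[of j] delta by (simp add: pos_divide_le_eq)
    qed
    also have "\<dots> \<le> (?c - 1) * K i"
      using c x by (intro mult_left_mono) (auto simp: budget_set_def)
    \<comment> \<open>The ratio \<open>?r i\<close> is the deviation bound divided by the benchmark
      \<open>(\<beta> i - 1) * K i\<close>.\<close>
    also have "\<dots> = ?r i * ((\<beta> i - 1) * K i)"
      using True by simp
    also have "\<dots> \<le> (1 + ?\<epsilon>) * ((\<beta> i - 1) * K i)"
      using ratio_le[OF True] True K by (intro mult_right_mono) auto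
    also have "\<dots> \<le> (1 + ?\<epsilon>) * tullock_utility v i b"
    proof (rule mult_left_mono)
      show "(\<beta> i - 1) * K i \<le> tullock_utility v i b"
        using best[of i] optimal_allocation_utility_ge[OF opt]
        unfolding tullock_utility_eq_fisher_utility[of b p, OF clear] by metis
      show "0 \<le> 1 + ?\<epsilon>" using eps by linarith
    qed
    finally show ?thesis .
  next
    case False
    then have b0: "b i j = 0" for j using inactive by simp
    \<comment> \<open>Since firm \<open>i\<close> bids nothing, the others already bid
      \<open>p j\<close> on each good, and \<open>c = 1\<close> suffices because
      \<open>\<beta> i \<le> 1\<close>.\<close>
    have "tullock_utility v i (b(i := x)) \<le> (1 - 1) * (\<Sum>j\<in>UNIV. x j)"
    proof (rule tullock_utility_deviation_le[where q = p, OF x])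
      show "0 < p j" for j by (rule p)
      show "p j \<le> (\<Sum>k\<in>UNIV. b k j) - b i j" for j by (simp add: clear b0)
      show "v i j \<le> 1 * p j" for j
        using order_trans[OF v_le[of i j], of 1] False p[of j] by (simp add: pos_divide_le_eq)
    qed simp
    \<comment> \<open>Both sides are 0, whatever the factor.\<close>
    also have "\<dots> = (1 + ?\<epsilon>) * tullock_utility v i b"
      by (simp add: tullock_utility_def b0)
    finally show ?thesis .
  qed
  then show ?thesis
    using eps b by (simp add: eps_nash_equilibrium_def)
qed

end
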